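(* Let $\mathcal{H}$ be a nonzero complex Hilbert space, let $n\ge 1$, let $A=[a_{ij}]\in \mathcal{M}_n(\mathbb{C})$ and let $B\in \mathcal{B}(\mathcal{H})$. Define matrices $C=[c_{ij}], C^\circ=[c^\circ_{ij}]\in\mathcal{M}_n(\mathbb{C})$ with diagonal entries $c_{ii}=c^\circ_{ii}=|a_{ii}|\,w(B)$ for $1\le i\le n$ and off-diagonal entries $$c_{ij}= w\left(\begin{bmatrix}0& a_{ij}\\ a_{ji}&0\end{bmatrix}\otimes B\right),\qquad c^\circ_{ij}=|a_{ij}|\,\|B\|,\qquad 1\le i\ne j\le n.$$ Then $$w(A\otimes B)\le w(C)\le w(C^\circ).$$
   Context: $\mathcal{B}(\mathcal{H})$ denotes the bounded linear operators on the complex Hilbert space $\mathcal{H}$, and $\|\cdot\|$ the operator norm. The numerical radius of a bounded operator $T$ on a complex Hilbert space $\mathcal{K}$ is $w(T)=\sup\{|\langle Tx,x\rangle| : x\in\mathcal{K},\ \|x\|=1\}$; for a matrix in $\mathcal{M}_n(\mathbb{C})$ it is taken on $\mathbb{C}^n$ with the standard inner product. For $A=[a_{ij}]\in\mathcal{M}_n(\mathbb{C})$ and $B\in\mathcal{B}(\mathcal{H})$, the Kronecker product $A\otimes B=[a_{ij}B]_{i,j=1}^n$ is the $n\times n$ operator matrix acting on $\mathcal{H}^n=\mathcal{H}^{\oplus n}$ (Hilbert space direct sum). *)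

theory Defs
  imports "HOL-Analysis.Analysis"
begin

class complex_vector = real_vector +
  fixes scaleC :: "complex \<Rightarrow> 'a \<Rightarrow> 'a" (infixr "*\<^sub>C" 75)
  assumes scaleC_add_right: "c *\<^sub>C (x + y) = c *\<^sub>C x + c *\<^sub>C y"
    and scaleC_add_left: "(c + d) *\<^sub>C x = c *\<^sub>C x + d *\<^sub>C x"
    and scaleC_scaleC: "c *\<^sub>C (d *\<^sub>C x) = (c * d) *\<^sub>C x"
    and scaleC_of_real: "complex_of_real r *\<^sub>C x = r *\<^sub>R x"

text \<open>The complex inner product is linear in the first argument. Its real part is the
  underlying real inner product, so positive definiteness and
  \<open>norm x = sqrt (Re (cinner x x))\<close> are inherited from \<^class>\<open>real_inner\<close>.\<close>

class complex_inner = complex_vector + real_inner +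
  fixes cinner :: "'a \<Rightarrow> 'a \<Rightarrow> complex"
  assumes cinner_commute: "cinner x y = cnj (cinner y x)"
    and cinner_add_left: "cinner (x + y) z = cinner x z + cinner y z"
    and cinner_scaleC_left: "cinner (c *\<^sub>C x) y = c * cinner x y"
    and Re_cinner: "Re (cinner x y) = inner x y"

class chilbert_space = complex_inner + complete_space

instantiation complex :: chilbert_space
begin

definition scaleC_complex :: "complex \<Rightarrow> complex \<Rightarrow> complex"
  where "scaleC_complex c x = c * x"

definition cinner_complex :: "complex \<Rightarrow> complex \<Rightarrow> complex"
  where "cinner_complex x y = x * cnj y"

instance
  by standard
    (simp_all add: scaleC_complex_def cinner_complex_def inner_complex_def algebra_simps
      scaleR_conv_of_real)

end

text \<open>The Hilbert space direct sum of copies of a Hilbert space, indexed by a finite type. Its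
  norm, inherited from the library, is the \<open>\<ell>\<^sup>2\<close> norm.\<close>

instantiation vec :: (complex_vector, finite) complex_vector
begin

definition scaleC_vec :: "complex \<Rightarrow> 'a ^ 'b \<Rightarrow> 'a ^ 'b"
  where "scaleC_vec c x = (\<chi> i. c *\<^sub>C (x $ i))"

instance
  by standard
    (simp_all add: scaleC_vec_def vec_eq_iff scaleC_add_right scaleC_add_left scaleC_scaleC
      scaleC_of_real)

end

instantiation vec :: (complex_inner, finite) complex_inner
begin

definition cinner_vec :: "'a ^ 'b \<Rightarrow> 'a ^ 'b \<Rightarrow> complex"
  where "cinner_vec x y = (\<Sum>i\<in>UNIV. cinner (x $ i) (y $ i))"

instance
proof
  fix x y z :: "'a ^ 'b" and c :: complex
  show "cinner x y = cnj (cinner y x)"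
    unfolding cinner_vec_def cnj_sum by (intro sum.cong refl cinner_commute)
  show "cinner (x + y) z = cinner x z + cinner y z"
    by (simp add: cinner_vec_def cinner_add_left sum.distrib)
  show "cinner (c *\<^sub>C x) y = c * cinner x y"
    by (simp add: cinner_vec_def scaleC_vec_def cinner_scaleC_left sum_distrib_left)
  show "Re (cinner x y) = inner x y"
    by (simp add: cinner_vec_def inner_vec_def Re_cinner)
qed

end

instance vec :: (chilbert_space, finite) chilbert_space ..

definition bounded_clinear :: "('a::complex_inner \<Rightarrow> 'b::complex_inner) \<Rightarrow> bool"
  where "bounded_clinear T \<longleftrightarrow> bounded_linear T \<and> (\<forall>c x. T (c *\<^sub>C x) = c *\<^sub>C T x)"

text \<open>A real supremum: meaningful only for bounded operators on a nonzero space.\<close>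

definition numerical_radius :: "('a::complex_inner \<Rightarrow> 'a) \<Rightarrow> real"
  where "numerical_radius T = Sup {cmod (cinner (T x) x) | x. norm x = 1}"

definition kronecker :: "complex ^ 'n ^ 'n \<Rightarrow> ('a::complex_vector \<Rightarrow> 'a) \<Rightarrow> 'a ^ 'n \<Rightarrow> 'a ^ 'n"
  where "kronecker A B x = (\<chi> i. \<Sum>j\<in>UNIV. (A $ i $ j) *\<^sub>C B (x $ j))"

end

theory Submission
  imports Defs
begin

text \<open>
  Write \<open>w\<close> for the numerical radius. Both inequalities come from comparing sesquilinear forms,
  and the vector of norms \<open>r i = norm (x $ i)\<close> carries the comparison.

  For \<open>x\<close> in the direct sum, \<open>cinner (kronecker A B x) x\<close> is the sum over \<open>i\<close>, \<open>j\<close> of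
  \<open>A $ i $ j * cinner (B (x $ j)) (x $ i)\<close>. In modulus, a diagonal term is at most
  \<open>cmod (A $ i $ i) * w B * r i\<^sup>2\<close>. The terms at \<open>(i, j)\<close> and \<open>(j, i)\<close> are taken together:
  their sum is the form of the 2-by-2 off-diagonal operator matrix at \<open>(x $ i, x $ j)\<close>.
  It does not change when one component is multiplied by a positive \<open>t\<close> and the other by \<open>1 / t\<close>,
  so one may balance the two norms, and the bound by \<open>w * (r i\<^sup>2 + r j\<^sup>2)\<close> sharpens to
  \<open>w * (2 * r i * r j)\<close> (lemma \<open>antidiagonal_form_le\<close>). Altogether the form of \<open>kronecker A B\<close>
  at \<open>x\<close> is bounded by the form of \<open>C\<close> at the vector \<open>r\<close>, which has the same norm as \<open>x\<close>.

  For the second inequality, Cauchy-Schwarz shows that an off-diagonal entry of \<open>C\<close> is at most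
  the mean of the entries of \<open>C'\<close> at \<open>(i, j)\<close> and \<open>(j, i)\<close>
  (lemma \<open>antidiagonal_numerical_radius_le\<close>). The entries of \<open>C\<close> are nonnegative, so its form at a
  complex vector \<open>z\<close> is at most its form at the moduli \<open>r i = cmod (z $ i)\<close>. Since \<open>r i * r j\<close> is
  symmetric, replacing the entries of \<open>C'\<close> by these means leaves its form at \<open>r\<close> unchanged.

  Both steps pair an entry with its transpose, which is lemma \<open>sum_pairs_le\<close>.
\<close>

section \<open>Complex inner products\<close>

lemma cinner_scaleC_right: "cinner x (c *\<^sub>C y) = cnj c * cinner x (y::'a::complex_inner)"
  by (metis cinner_commute cinner_scaleC_left complex_cnj_mult)

lemma cinner_add_right: "cinner x (y + z) = cinner x y + cinner x (z::'a::complex_inner)"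
  by (metis cinner_commute cinner_add_left complex_cnj_add)

lemma cinner_zero_left [simp]: "cinner 0 (x::'a::complex_inner) = 0"
  using cinner_add_left[of 0 0 x] by simp

lemma cinner_zero_right [simp]: "cinner (x::'a::complex_inner) 0 = 0"
  using cinner_add_right[of x 0 0] by simp

lemma cinner_scaleR_left: "cinner (t *\<^sub>R x) (y::'a::complex_inner) = of_real t * cinner x y"
  by (metis cinner_scaleC_left scaleC_of_real)

lemma cinner_scaleR_right: "cinner x (t *\<^sub>R (y::'a::complex_inner)) = of_real t * cinner x y"
  by (metis cinner_scaleC_right scaleC_of_real complex_cnj_complex_of_real)

lemma cinner_sum_left: "cinner (\<Sum>i\<in>S. f i) (y::'a::complex_inner) = (\<Sum>i\<in>S. cinner (f i) y)"
  by (induction S rule: infinite_finite_induct) (auto simp: cinner_add_left)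

lemma norm_scaleC: "norm (c *\<^sub>C (x::'a::complex_inner)) = cmod c * norm x"
proof -
  have "Im (cinner x x) = 0"
    using arg_cong[OF cinner_commute[of x x], of Im] by simp
  then have *: "cinner x x = of_real ((norm x)\<^sup>2)"
    by (simp add: complex_eq_iff Re_cinner power2_norm_eq_inner)
  have "cinner (c *\<^sub>C x) (c *\<^sub>C x) = (c * cnj c) * of_real ((norm x)\<^sup>2)"
    by (simp only: cinner_scaleC_left cinner_scaleC_right * mult_ac)
  also have "\<dots> = of_real ((cmod c * norm x)\<^sup>2)"
    by (simp only: complex_norm_square[symmetric] of_real_mult[symmetric] power_mult_distrib)
  finally have "inner (c *\<^sub>C x) (c *\<^sub>C x) = (cmod c * norm x)\<^sup>2"
    by (metis Re_cinner Re_complex_of_real)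
  then have "(norm (c *\<^sub>C x))\<^sup>2 = (cmod c * norm x)\<^sup>2"
    by (simp only: power2_norm_eq_inner)
  then show ?thesis
    by (simp add: power2_eq_iff_nonneg)
qed

text \<open>Rotating \<open>x\<close> by a phase makes the complex inner product real and nonnegative, so that it
  agrees with the real one, for which the inequality is known.\<close>

lemma complex_Cauchy_Schwarz: "cmod (cinner x (y::'a::complex_inner)) \<le> norm x * norm y"
proof (cases "cinner x y = 0")
  case True
  then show ?thesis by simp
next
  case False
  let ?z = "cinner x y"
  define c where "c = cnj ?z / of_real (cmod ?z)"
  have c1: "cmod c = 1"
    using False by (simp add: c_def norm_divide)
  have "c * ?z = of_real (cmod ?z)"
    using False by (simp add: c_def field_simps complex_norm_square[symmetric] power2_eq_square)
  then have "cmod ?z = Re (cinner (c *\<^sub>C x) y)"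
    by (simp add: cinner_scaleC_left)
  also have "\<dots> \<le> norm (c *\<^sub>C x) * norm y"
    unfolding Re_cinner by (rule norm_cauchy_schwarz)
  finally show ?thesis
    by (simp add: norm_scaleC c1)
qed

section \<open>The numerical radius\<close>

lemma bounded_clinear_form_le:
  fixes T :: "'a::complex_inner \<Rightarrow> 'a"
  assumes "bounded_clinear T"
  shows "cmod (cinner (T x) y) \<le> onorm T * norm x * norm y"
proof -
  have "cmod (cinner (T x) y) \<le> norm (T x) * norm y"
    by (rule complex_Cauchy_Schwarz)
  also have "\<dots> \<le> onorm T * norm x * norm y"
    using assms onorm[of T x] by (auto simp: bounded_clinear_def intro: mult_right_mono)
  finally show ?thesis .
qed

lemma cmod_cinner_le_numerical_radius:
  fixes T :: "'a::complex_inner \<Rightarrow> 'a"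
  assumes T: "bounded_clinear T"
  shows "cmod (cinner (T x) x) \<le> numerical_radius T * (norm x)\<^sup>2"
proof (cases "x = 0")
  case True
  then show ?thesis by simp
next
  case False
  let ?u = "(1 / norm x) *\<^sub>R x"
  have "bdd_above {cmod (cinner (T x) x) | x. norm x = 1}"
  proof (rule bdd_aboveI[of _ "onorm T"])
    fix s
    assume "s \<in> {cmod (cinner (T x) x) | x. norm x = 1}"
    then obtain x where "s = cmod (cinner (T x) x)" "norm x = 1"
      by blast
    then show "s \<le> onorm T"
      using bounded_clinear_form_le[OF T, of x x] by simp
  qed
  moreover have "norm ?u = 1"
    using False by simp
  ultimately have *: "cmod (cinner (T ?u) ?u) \<le> numerical_radius T"
    unfolding numerical_radius_def by (intro cSup_upper) auto
  have "T ?u = (1 / norm x) *\<^sub>R T x"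
    using T by (simp add: bounded_clinear_def bounded_linear.linear linear_scale)
  then have "cmod (cinner (T ?u) ?u) = cmod (cinner (T x) x) / (norm x)\<^sup>2"
    by (simp only: cinner_scaleR_left cinner_scaleR_right norm_mult)
      (simp add: norm_divide power2_eq_square)
  with * False show ?thesis
    by (simp add: divide_le_eq)
qed

text \<open>A supremum over the empty set says nothing, so the space has to be nonzero.\<close>

lemma numerical_radius_le:
  fixes T :: "'a::complex_inner \<Rightarrow> 'a"
  assumes "\<exists>x::'a. x \<noteq> 0"
    and "\<And>x. norm x = 1 \<Longrightarrow> cmod (cinner (T x) x) \<le> K"
  shows "numerical_radius T \<le> K"
proof -
  obtain x :: 'a where "x \<noteq> 0"
    using assms(1) by blast
  then have "norm ((1 / norm x) *\<^sub>R x) = 1"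
    by simp
  then show ?thesis
    unfolding numerical_radius_def using assms(2) by (intro cSup_least) blast+
qed

lemma numerical_radius_nonneg:
  fixes T :: "'a::complex_inner \<Rightarrow> 'a"
  assumes "\<exists>x::'a. x \<noteq> 0" and T: "bounded_clinear T"
  shows "0 \<le> numerical_radius T"
proof -
  obtain x :: 'a where "x \<noteq> 0"
    using assms(1) by blast
  then show ?thesis
    using order_trans[OF norm_ge_zero cmod_cinner_le_numerical_radius[OF T, of x]]
    by (simp add: zero_le_mult_iff)
qed

lemma vec_nonzero:
  assumes "\<exists>x::'a::zero. x \<noteq> 0"
  shows "\<exists>x::'a ^ 'n. x \<noteq> 0"
proof -
  obtain x :: 'a where "x \<noteq> 0"
    using assms by blast
  then have "(\<chi> i. x) \<noteq> (0 :: 'a ^ 'n)"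
    by (simp add: vec_eq_iff)
  then show ?thesis by blast
qed

section \<open>Operator matrices\<close>

lemma norm_vec_power2: "(norm (x::'a::real_inner ^ 'n))\<^sup>2 = (\<Sum>i\<in>UNIV. (norm (x $ i))\<^sup>2)"
  by (simp add: power2_norm_eq_inner inner_vec_def)

lemma bounded_clinear_kronecker:
  fixes B :: "'h::complex_inner \<Rightarrow> 'h" and A :: "complex ^ 'n ^ 'n"
  assumes "bounded_clinear B"
  shows "bounded_clinear (kronecker A B)"
proof -
  have B: "bounded_linear B" and Bc: "\<And>c x. B (c *\<^sub>C x) = c *\<^sub>C B x"
    using assms by (auto simp: bounded_clinear_def)
  have clin: "kronecker A B (c *\<^sub>C x) = c *\<^sub>C kronecker A B x" for c x
    by (simp add: kronecker_def vec_eq_iff scaleC_vec_def Bc scaleC_scaleC mult.commute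
        Modules.additive.sum[of "(*\<^sub>C) c"] Modules.additive_def scaleC_add_right)
  have "bounded_linear (kronecker A B)"
  proof (rule bounded_linear_intro)
    show "kronecker A B (x + y) = kronecker A B x + kronecker A B y" for x y
      by (simp add: kronecker_def vec_eq_iff linear_add[OF bounded_linear.linear[OF B]]
          scaleC_add_right sum.distrib)
    show "kronecker A B (r *\<^sub>R x) = r *\<^sub>R kronecker A B x" for r x
      using clin[of "of_real r" x] by (simp add: scaleC_of_real)
    show "norm (kronecker A B x) \<le> norm x * (\<Sum>i\<in>UNIV. \<Sum>j\<in>UNIV. cmod (A $ i $ j) * onorm B)" for x
    proof -
      have "norm (kronecker A B x) \<le> (\<Sum>i\<in>UNIV. norm (kronecker A B x $ i))"
        unfolding norm_vec_def by (rule L2_set_le_sum) simp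
      also have "\<dots> \<le> (\<Sum>i\<in>UNIV. \<Sum>j\<in>UNIV. cmod (A $ i $ j) * (onorm B * norm x))"
      proof (rule sum_mono)
        fix i
        have "norm (B (x $ j)) \<le> onorm B * norm x" for j
          using onorm[OF B, of "x $ j"] Finite_Cartesian_Product.norm_nth_le[of x j]
            onorm_pos_le[OF B] by (meson mult_left_mono order_trans)
        then show "norm (kronecker A B x $ i) \<le> (\<Sum>j\<in>UNIV. cmod (A $ i $ j) * (onorm B * norm x))"
          by (auto simp: kronecker_def norm_scaleC intro!: sum_norm_le mult_left_mono)
      qed
      finally show ?thesis
        by (simp add: sum_distrib_left algebra_simps)
    qed
  qed
  then show ?thesis
    using clin by (simp add: bounded_clinear_def)
qed

lemma cinner_kronecker:
  "cinner (kronecker A B x) x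
    = (\<Sum>i\<in>UNIV. \<Sum>j\<in>UNIV. A $ i $ j * cinner (B (x $ j)) (x $ i))"
  by (simp add: kronecker_def cinner_vec_def cinner_sum_left cinner_scaleC_left)

text \<open>A scalar matrix is an operator matrix over the Hilbert space of complex numbers, so the facts
  about \<open>kronecker\<close> cover both kinds of operator in the theorem.\<close>

lemma matrix_vector_mult_eq_kronecker: "((*v) M) = kronecker M (\<lambda>z::complex. z)"
  by (auto simp: fun_eq_iff vec_eq_iff kronecker_def matrix_vector_mult_def scaleC_complex_def)

lemma bounded_clinear_matrix: "bounded_clinear ((*v) (M :: complex ^ 'n ^ 'n))"
  unfolding matrix_vector_mult_eq_kronecker
  by (rule bounded_clinear_kronecker) (simp add: bounded_clinear_def bounded_linear_ident)

text \<open>For a real matrix, testing the numerical radius on the real vector \<open>r\<close> turns it into a bound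
  for the real quadratic form.\<close>

lemma real_form_le_numerical_radius:
  fixes M :: "complex ^ 'n ^ 'n"
  assumes M: "\<And>i j. M $ i $ j = of_real (m i j)"
  shows "(\<Sum>i\<in>UNIV. \<Sum>j\<in>UNIV. m i j * (r i * r j))
           \<le> numerical_radius ((*v) M) * (\<Sum>i\<in>UNIV. (r i)\<^sup>2)"
proof -
  let ?x = "(\<chi> i. of_real (r i)) :: complex ^ 'n"
  have "cinner (M *v ?x) ?x = of_real (\<Sum>i\<in>UNIV. \<Sum>j\<in>UNIV. m i j * (r i * r j))"
    unfolding matrix_vector_mult_eq_kronecker cinner_kronecker
    by (simp add: M cinner_complex_def mult_ac)
  then have "(\<Sum>i\<in>UNIV. \<Sum>j\<in>UNIV. m i j * (r i * r j)) \<le> cmod (cinner (M *v ?x) ?x)"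
    by (simp only: norm_of_real abs_ge_self)
  also have "\<dots> \<le> numerical_radius ((*v) M) * (\<Sum>i\<in>UNIV. (r i)\<^sup>2)"
    using cmod_cinner_le_numerical_radius[OF bounded_clinear_matrix[of M], of ?x]
    by (simp add: norm_vec_power2)
  finally show ?thesis .
qed

section \<open>Two-by-two off-diagonal operator matrices\<close>

abbreviation (input) antidiagonal :: "complex \<Rightarrow> complex \<Rightarrow> complex ^ 2 ^ 2"
  where "antidiagonal a b \<equiv> vector [vector [0, a], vector [b, 0]]"

lemma cinner_antidiagonal:
  "cinner (kronecker (antidiagonal a b) B x) x
    = a * cinner (B (x $ 2)) (x $ 1) + b * cinner (B (x $ 1)) (x $ 2)"
  by (simp add: cinner_kronecker sum_2)

text \<open>The left-hand side is unchanged when \<open>u\<close> and \<open>v\<close> are multiplied by \<open>t\<close> and \<open>1 / t\<close>. The choice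
  of \<open>t\<close> that gives both components the same norm turns the sum of squares into twice the
  product.\<close>

lemma antidiagonal_form_le:
  fixes B :: "'h::complex_inner \<Rightarrow> 'h"
  assumes B: "bounded_clinear B"
  shows "cmod (a * cinner (B v) u + b * cinner (B u) v)
           \<le> 2 * numerical_radius (kronecker (antidiagonal a b) B) * (norm u * norm v)"
proof (cases "u = 0 \<or> v = 0")
  case True
  moreover have "B 0 = 0"
    using B by (simp add: bounded_clinear_def bounded_linear.linear linear_0)
  ultimately show ?thesis by auto
next
  case False
  define t where "t = sqrt (norm v / norm u)"
  have t: "t > 0" "t\<^sup>2 = norm v / norm u"
    using False by (auto simp: t_def)
  have Bs: "B (s *\<^sub>R y) = s *\<^sub>R B y" for s y
    using B by (simp add: bounded_clinear_def bounded_linear.linear linear_scale)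
  define x :: "'h ^ 2" where "x = vector [t *\<^sub>R u, (1 / t) *\<^sub>R v]"
  have "cinner (kronecker (antidiagonal a b) B x) x = a * cinner (B v) u + b * cinner (B u) v"
    using t(1) by (simp add: cinner_antidiagonal x_def Bs cinner_scaleR_left cinner_scaleR_right
        del: scaleR_scaleR)
  moreover have "(norm x)\<^sup>2 = 2 * (norm u * norm v)"
  proof -
    have "(norm x)\<^sup>2 = t\<^sup>2 * (norm u)\<^sup>2 + (norm v)\<^sup>2 / t\<^sup>2"
      by (simp add: norm_vec_power2 sum_2 x_def power_mult_distrib power_divide)
    also have "\<dots> = 2 * (norm u * norm v)"
      using False unfolding t(2) by (simp add: power2_eq_square)
    finally show ?thesis .
  qed
  ultimately show ?thesis
    using cmod_cinner_le_numerical_radius[OF bounded_clinear_kronecker[OF B],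
        of "antidiagonal a b" x]
    by (simp add: mult_ac)
qed

text \<open>For a unit vector the product of the norms of the two components is at most one half, which
  accounts for the mean of \<open>cmod a\<close> and \<open>cmod b\<close>.\<close>

lemma antidiagonal_numerical_radius_le:
  fixes B :: "'h::complex_inner \<Rightarrow> 'h"
  assumes nz: "\<exists>x::'h. x \<noteq> 0" and B: "bounded_clinear B"
  shows "2 * numerical_radius (kronecker (antidiagonal a b) B) \<le> (cmod a + cmod b) * onorm B"
proof -
  have "numerical_radius (kronecker (antidiagonal a b) B) \<le> (cmod a + cmod b) * onorm B / 2"
  proof (rule numerical_radius_le[OF vec_nonzero[OF nz]])
    fix x :: "'h ^ 2"
    assume x: "norm x = 1"
    let ?p = "norm (x $ 1)" and ?q = "norm (x $ 2)"
    have "?p\<^sup>2 + ?q\<^sup>2 = 1"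
      using norm_vec_power2[of x] x by (simp add: sum_2)
    then have pq: "?p * ?q \<le> 1 / 2"
      using sum_squares_bound[of ?p ?q] by simp
    have "cmod (cinner (kronecker (antidiagonal a b) B x) x)
        \<le> cmod a * cmod (cinner (B (x $ 2)) (x $ 1)) + cmod b * cmod (cinner (B (x $ 1)) (x $ 2))"
      unfolding cinner_antidiagonal by (metis norm_mult norm_triangle_ineq)
    also have "\<dots> \<le> cmod a * (onorm B * ?q * ?p) + cmod b * (onorm B * ?p * ?q)"
      by (intro add_mono mult_left_mono bounded_clinear_form_le[OF B]) auto
    also have "\<dots> = (cmod a + cmod b) * onorm B * (?p * ?q)"
      by (simp add: algebra_simps)
    also have "\<dots> \<le> (cmod a + cmod b) * onorm B * (1 / 2)"
      using B by (intro mult_left_mono[OF pq] mult_nonneg_nonneg add_nonneg_nonneg)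
        (auto simp: bounded_clinear_def onorm_pos_le)
    finally show "cmod (cinner (kronecker (antidiagonal a b) B x) x)
        \<le> (cmod a + cmod b) * onorm B / 2"
      by simp
  qed
  then show ?thesis by simp
qed

section \<open>Comparison of the three forms\<close>

text \<open>A double sum equals half the double sum of its symmetrized terms, so it suffices to compare
  the symmetrized terms.\<close>

lemma sum_pairs_le:
  fixes f :: "'n::finite \<Rightarrow> 'n \<Rightarrow> 'a::real_normed_vector"
  assumes "\<And>i j. norm (f i j + f j i) \<le> g i j + g j i"
  shows "norm (\<Sum>i\<in>UNIV. \<Sum>j\<in>UNIV. f i j) \<le> (\<Sum>i\<in>UNIV. \<Sum>j\<in>UNIV. g i j)"
proof -
  have sym: "(\<Sum>i\<in>UNIV. \<Sum>j\<in>UNIV. h i j + h j i) = 2 *\<^sub>R (\<Sum>i\<in>UNIV. \<Sum>j\<in>UNIV. h i j)"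
    for h :: "'n \<Rightarrow> 'n \<Rightarrow> 'b::real_vector"
    using sum.swap[of "\<lambda>i j. h j i" UNIV UNIV] by (simp add: sum.distrib scaleR_2)
  have "norm (\<Sum>i\<in>UNIV. \<Sum>j\<in>UNIV. f i j + f j i) \<le> (\<Sum>i\<in>UNIV. \<Sum>j\<in>UNIV. g i j + g j i)"
    by (intro sum_norm_le assms)
  then show ?thesis
    unfolding sym by simp
qed

theorem theorem1p3:
  fixes A C C' :: "complex ^ 'n ^ 'n"
    and B :: "'h::chilbert_space \<Rightarrow> 'h"
  assumes nonzero: "\<exists>x::'h. x \<noteq> 0"
    and B: "bounded_clinear B"
    and C_diag: "\<And>i. C $ i $ i = of_real (cmod (A $ i $ i) * numerical_radius B)"
    and C_offdiag: "\<And>i j. i \<noteq> j \<Longrightarrow> C $ i $ j = of_real (numerical_radius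
           (kronecker (vector [vector [0, A $ i $ j], vector [A $ j $ i, 0]] :: complex ^ 2 ^ 2) B))"
    and C'_diag: "\<And>i. C' $ i $ i = of_real (cmod (A $ i $ i) * numerical_radius B)"
    and C'_offdiag: "\<And>i j. i \<noteq> j \<Longrightarrow> C' $ i $ j = of_real (cmod (A $ i $ j) * onorm B)"
  shows "numerical_radius (kronecker A B) \<le> numerical_radius ((*v) C) \<and>
         numerical_radius ((*v) C) \<le> numerical_radius ((*v) C')"
proof
  define c where "c i j = Re (C $ i $ j)" for i j
  define c' where "c' i j = Re (C' $ i $ j)" for i j
  have C: "C $ i $ j = of_real (c i j)" for i j
    by (cases "i = j") (simp_all add: c_def C_diag C_offdiag)
  have C': "C' $ i $ j = of_real (c' i j)" for i j
    by (cases "i = j") (simp_all add: c'_def C'_diag C'_offdiag)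
  have diag: "c i i = cmod (A $ i $ i) * numerical_radius B" "c' i i = c i i" for i
    by (simp_all add: c_def c'_def C_diag C'_diag)
  have off: "c i j = numerical_radius (kronecker (antidiagonal (A $ i $ j) (A $ j $ i)) B)"
    if "i \<noteq> j" for i j
    using that by (simp add: c_def C_offdiag)
  have off': "c' i j = cmod (A $ i $ j) * onorm B" if "i \<noteq> j" for i j
    using that by (simp add: c'_def C'_offdiag)

  show "numerical_radius (kronecker A B) \<le> numerical_radius ((*v) C)"
  proof (rule numerical_radius_le[OF vec_nonzero[OF nonzero]])
    fix x :: "'h ^ 'n"
    assume x: "norm x = 1"
    let ?r = "\<lambda>i. norm (x $ i)"
    let ?f = "\<lambda>i j. A $ i $ j * cinner (B (x $ j)) (x $ i)"
    \<comment> \<open>A bound for an unordered pair, hence the factor 2; on the diagonal the term occurs twice.\<close>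
    have pair: "cmod (?f i j + ?f j i) \<le> 2 * (c i j * (?r i * ?r j))" for i j
    proof (cases "i = j")
      case True
      have "cmod (?f i i) \<le> c i i * (?r i * ?r i)"
        using mult_left_mono[OF cmod_cinner_le_numerical_radius[OF B, of "x $ i"],
            of "cmod (A $ i $ i)"]
        by (simp add: diag norm_mult power2_eq_square mult_ac)
      then show ?thesis
        using True by (simp add: norm_mult)
    next
      case False
      then show ?thesis
        using antidiagonal_form_le[OF B, of "A $ i $ j" "x $ j" "x $ i" "A $ j $ i"]
        by (simp add: off mult_ac)
    qed
    have "cmod (?f i j + ?f j i) \<le> c i j * (?r i * ?r j) + c j i * (?r j * ?r i)" for i j
      using pair[of i j] pair[of j i] by (simp add: add.commute)
    then have "cmod (cinner (kronecker A B x) x)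
        \<le> (\<Sum>i\<in>UNIV. \<Sum>j\<in>UNIV. c i j * (?r i * ?r j))"
      unfolding cinner_kronecker by (rule sum_pairs_le)
    also have "\<dots> \<le> numerical_radius ((*v) C)"
      using real_form_le_numerical_radius[OF C, of ?r] norm_vec_power2[of x] x by simp
    finally show "cmod (cinner (kronecker A B x) x) \<le> numerical_radius ((*v) C)" .
  qed

  show "numerical_radius ((*v) C) \<le> numerical_radius ((*v) C')"
  proof (rule numerical_radius_le)
    show "\<exists>z::complex ^ 'n. z \<noteq> 0"
      by (intro vec_nonzero exI[of _ 1]) simp
    fix z :: "complex ^ 'n"
    assume z: "norm z = 1"
    let ?r = "\<lambda>i. cmod (z $ i)"
    let ?f = "\<lambda>i j. C $ i $ j * cinner (z $ j) (z $ i)"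
    have c_nonneg: "0 \<le> c i j" for i j
      using numerical_radius_nonneg[OF nonzero B]
        numerical_radius_nonneg[OF vec_nonzero[OF nonzero] bounded_clinear_kronecker[OF B]]
      by (cases "i = j") (simp_all add: diag off)
    have le: "2 * c i j \<le> c' i j + c' j i" for i j
    proof (cases "i = j")
      case False
      then show ?thesis
        using antidiagonal_numerical_radius_le[OF nonzero B, of "A $ i $ j" "A $ j $ i"]
        by (simp add: off off' distrib_right)
    qed (simp add: diag)
    have "cmod (?f i j + ?f j i) \<le> c' i j * (?r i * ?r j) + c' j i * (?r j * ?r i)" for i j
    proof -
      have "cmod (?f i j + ?f j i) \<le> (c i j + c j i) * (?r i * ?r j)"
        using norm_triangle_ineq[of "?f i j" "?f j i"] c_nonneg
        by (simp add: C cinner_complex_def norm_mult algebra_simps)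
      also have "\<dots> \<le> (c' i j + c' j i) * (?r i * ?r j)"
        using le[of i j] le[of j i] by (intro mult_right_mono) auto
      finally show ?thesis
        by (simp add: algebra_simps)
    qed
    then have "cmod (cinner (C *v z) z) \<le> (\<Sum>i\<in>UNIV. \<Sum>j\<in>UNIV. c' i j * (?r i * ?r j))"
      unfolding matrix_vector_mult_eq_kronecker cinner_kronecker by (rule sum_pairs_le)
    also have "\<dots> \<le> numerical_radius ((*v) C')"
      using real_form_le_numerical_radius[OF C', of ?r] norm_vec_power2[of z] z by simp
    finally show "cmod (cinner (C *v z) z) \<le> numerical_radius ((*v) C')" .
  qed
qed

end
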